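(* In the category $\mathbf{W}$ (the universal Weyl category, defined in the context) there is an isomorphism $$Q_-\otimes Q_+\;\cong\;(Q_+\otimes Q_-)\oplus C_0 .$$
   Context: Ground field $\mathbb C(q)$, $q$ a formal parameter; $[n]=\frac{q^n-q^{-n}}{q-q^{-1}}$. **The category $\mathbf W'$.** $\mathbf W'$ is the additive $\mathbb C(q)$-linear strict monoidal category, with unit object $\mathbb 1$, whose objects are finite direct sums of tensor words in two objects $Q_+,Q_-$. Write $1_\pm$ for the identity of $Q_\pm$. (In the diagrammatic description, $Q_+$ is an upward strand, $Q_-$ a downward strand, composition is vertical stacking.) Morphisms are generated, under composition, tensor product and linear combination, by - $\eta:\mathbb 1\to Q_-\otimes Q_+$, $\varepsilon: Q_-\otimes Q_+\to\mathbb 1$, $\eta':\mathbb 1\to Q_+\otimes Q_-$, $\varepsilon':Q_+\otimes Q_-\to\mathbb 1$ (oriented cups and caps); - $E:Q_+\otimes Q_+\to Q_+\otimes Q_+$ (the "cupcap"); - $b_k\in\mathrm{End}(\mathbb 1)$ for $k\in\mathbb Z$ ("boxes"). An element $z\in\mathrm{End}(\mathbb 1)$ may be tensored on the left or on the right of, or inserted between, other morphisms. Planar isotopy relations: the zigzag identities $(\varepsilon'\otimes 1_+)(1_+\otimes\eta)=1_+=(1_+\otimes\varepsilon)(\eta'\otimes1_+)$, $(1_-\otimes\varepsilon')(\eta\otimes1_-)=1_-=(\varepsilon\otimes1_-)(1_-\otimes\eta')$, and the left and right mates of $E$ (its rotations by $\pm180^\circ$ using the cups and caps) coincide; call the common mate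 $E^*:Q_-\otimes Q_-\to Q_-\otimes Q_-$. Notation. - $b_k^\dagger:=\varepsilon\eta-b_{k-1}$ for $k\in\mathbb Z$. - $P:=1_+-[2]\,(1_+\otimes\varepsilon')(E\otimes1_-)(1_+\otimes\eta')$. - Bubbles $c_k\in\mathrm{End}(\mathbb 1)$: $c_0:=\varepsilon\circ\big(1_-\otimes[\varepsilon'(P\otimes1_-)\eta']\otimes1_+\big)\circ\eta$; $c_{k+1}:=\varepsilon'(1_+\otimes\varepsilon'\otimes1_-)(E\otimes c_k\otimes1_-\otimes1_-)(1_+\otimes\eta'\otimes1_-)\eta'$ for $k\ge0$; $c_k:=0$ for $k<0$. Relations (for all integers $k,j\ge0$ unless said otherwise): 1. $[2]^3(E\otimes1_+)(1_+\otimes E)(E\otimes1_+)=[2]\,E\otimes1_+$ and $[2]^3(1_+\otimes E)(E\otimes1_+)(1_+\otimes E)=[2]\,1_+\otimes E$. 2. $[2]^2(E\otimes1_-)(1_+\otimes\eta'\varepsilon')(E\otimes1_-)=[2]\,E\otimes1_-$ and $[2]^2(1_-\otimes E)(\eta\varepsilon\otimes1_+)(1_-\otimes E)=[2]\,1_-\otimes E$. 3. $[2](\varepsilon\otimes1_+)(1_-\otimes E)(\eta\otimes1_+)=1_+$ and $[2](1_+\otimes\varepsilon')(E\otimes1_-)(1_+\otimes\eta')=(1-c_0)\otimes1_+$. 4. $\varepsilon\eta=[2]$; $\ \varepsilon(1_-\otimes c_k\otimes1_+)\eta=b_{-2k+1}c_{k-1}+b_{-2k}^\dagger c_k$. 5.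 $\varepsilon'\eta'=[2]-c_0b_0^\dagger$; $\ \varepsilon'(1_+\otimes c_k\otimes1_-)\eta'=b_{-2k-1}c_k+b_{-2k-2}^\dagger c_{k+1}$. 6. $c_k\otimes1_+=c_k\otimes1_+\otimes(c_k+c_{k-1})$; $\ 1_+\otimes c_k=(c_k+c_{k+1})\otimes1_+\otimes c_k$. 7. $\big[(1_-\otimes1_-\otimes E)(1_-\otimes\eta\otimes1_+)\eta\big]\circ\big[\varepsilon(1_-\otimes\varepsilon\otimes1_+)(1_-\otimes1_-\otimes E)\big]=E^*\otimes E$; $\ c_0\otimes E=0$. 8. $c_kc_j=\delta_{kj}c_k$; $\ b_k\otimes1_+=1_+\otimes b_{k+1}$ for all $k\in\mathbb Z$. 9. $b_k^\dagger b_k=1$ for $k\ge0$. 10. $c_k\otimes1_-\otimes c_k\otimes1_+\otimes c_k=(1_-\otimes c_k\otimes1_+)\,\eta\,(c_kb_{-2k})\,\varepsilon\,(1_-\otimes c_k\otimes1_+)$; $c_{k-1}\otimes1_-\otimes c_k\otimes1_+\otimes c_{k-1}=(1_-\otimes c_k\otimes1_+)\,\eta\,(c_{k-1}b_{-2k+1}^\dagger)\,\varepsilon\,(1_-\otimes c_k\otimes1_+)$. 11. Writing juxtaposition for $\otimes$ and $1$ for $1_+$: $[2]\,E\circ(1\,c_k\,1)=[2]\,\big((1\,c_{k+1}\,1)\circ E\big)\,c_k+[2]\,c_k\,\big((1\,c_{k-1}\,1)\circ E\big)+c_{k+1}1c_k1c_k\,b_{-2k}^\dagger+c_k1c_k1c_{k-1}\,b_{-2k+1}-c_{k+1}1c_{k+1}1c_k\,b_{-2k-1}-c_k1c_{k-1}1c_{k-1}\,b_{-2k+2}^\dagger$.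 **The category $\mathbf W$.** $\mathbf W$ is the Karoubi envelope (idempotent completion) of $\mathbf W'$. For $k\ge0$, $C_k$ denotes the image of the idempotent $c_k\in\mathrm{End}(\mathbb 1)$, an object of $\mathbf W$. *)

theory Defs
  imports "HOL-Computational_Algebra.Fraction_Field" "HOL-Computational_Algebra.Polynomial"
    Complex_Main
begin

type_synonym scalar = "complex poly fract"

definition qpar :: scalar where
  "qpar = Fraction_Field.Fract [:0, 1:] 1"

definition qint :: "int \<Rightarrow> scalar" where
  "qint n = (qpar powi n - qpar powi (- n)) / (qpar - inverse qpar)"

datatype sign = Plus | Minus

text \<open>A tensor word in the two generating objects; the tensor product of words is
  concatenation and the unit object is the empty word.\<close>
type_synonym word = "sign list"

text \<open>The composite \<open>g \<bullet> f\<close> is \<open>f\<close> followed by \<open>g\<close>; \<open>Ecc\<close> is the cupcap. Terms carry enough typing information for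
  source, target and well-typedness to be computed.\<close>
datatype tm =
    Idt word
  | Zro word word
  | Eta | Eps | Eta' | Eps'
  | Ecc
  | Box int
  | Comp tm tm (infixr "\<bullet>" 70)
  | Tens tm tm (infixr "\<otimes>" 75)
  | Plus_tm tm tm (infixl "\<oplus>" 65)
  | Scal scalar tm (infixr "\<odot>" 68)

abbreviation Diff_tm :: "tm \<Rightarrow> tm \<Rightarrow> tm" (infixl "\<ominus>" 65) where
  "f \<ominus> g \<equiv> f \<oplus> ((- 1) \<odot> g)"

abbreviation id_unit :: tm ("\<one>") where "\<one> \<equiv> Idt []"
abbreviation id_plus :: tm ("\<one>\<^sub>+") where "\<one>\<^sub>+ \<equiv> Idt [Plus]"
abbreviation id_minus :: tm ("\<one>\<^sub>-") where "\<one>\<^sub>- \<equiv> Idt [Minus]"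

primrec tdom :: "tm \<Rightarrow> word" where
  "tdom (Idt x) = x"
| "tdom (Zro x y) = x"
| "tdom Eta = []"
| "tdom Eps = [Minus, Plus]"
| "tdom Eta' = []"
| "tdom Eps' = [Plus, Minus]"
| "tdom Ecc = [Plus, Plus]"
| "tdom (Box k) = []"
| "tdom (g \<bullet> f) = tdom f"
| "tdom (f \<otimes> g) = tdom f @ tdom g"
| "tdom (f \<oplus> g) = tdom f"
| "tdom (a \<odot> f) = tdom f"

primrec tcod :: "tm \<Rightarrow> word" where
  "tcod (Idt x) = x"
| "tcod (Zro x y) = y"
| "tcod Eta = [Minus, Plus]"
| "tcod Eps = []"
| "tcod Eta' = [Plus, Minus]"
| "tcod Eps' = []"
| "tcod Ecc = [Plus, Plus]"
| "tcod (Box k) = []"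
| "tcod (g \<bullet> f) = tcod g"
| "tcod (f \<otimes> g) = tcod f @ tcod g"
| "tcod (f \<oplus> g) = tcod f"
| "tcod (a \<odot> f) = tcod f"

primrec wt :: "tm \<Rightarrow> bool" where
  "wt (Idt x) \<longleftrightarrow> True"
| "wt (Zro x y) \<longleftrightarrow> True"
| "wt Eta \<longleftrightarrow> True"
| "wt Eps \<longleftrightarrow> True"
| "wt Eta' \<longleftrightarrow> True"
| "wt Eps' \<longleftrightarrow> True"
| "wt Ecc \<longleftrightarrow> True"
| "wt (Box k) \<longleftrightarrow> True"
| "wt (g \<bullet> f) \<longleftrightarrow> wt g \<and> wt f \<and> tcod f = tdom g"
| "wt (f \<otimes> g) \<longleftrightarrow> wt f \<and> wt g"
| "wt (f \<oplus> g) \<longleftrightarrow> wt f \<and> wt g \<and> tdom f = tdom g \<and> tcod f = tcod g"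
| "wt (a \<odot> f) \<longleftrightarrow> wt f"

definition Bdag :: "int \<Rightarrow> tm" where
  "Bdag k = Eps \<bullet> Eta \<ominus> Box (k - 1)"

definition Pmor :: tm where
  "Pmor = \<one>\<^sub>+ \<ominus> qint 2 \<odot> ((\<one>\<^sub>+ \<otimes> Eps') \<bullet> (Ecc \<otimes> \<one>\<^sub>-) \<bullet> (\<one>\<^sub>+ \<otimes> Eta'))"

primrec bubble :: "nat \<Rightarrow> tm" where
  "bubble 0 = Eps \<bullet> (\<one>\<^sub>- \<otimes> (Eps' \<bullet> (Pmor \<otimes> \<one>\<^sub>-) \<bullet> Eta') \<otimes> \<one>\<^sub>+) \<bullet> Eta"
| "bubble (Suc k) = Eps' \<bullet> (\<one>\<^sub>+ \<otimes> Eps' \<otimes> \<one>\<^sub>-) \<bullet> (Ecc \<otimes> bubble k \<otimes> \<one>\<^sub>- \<otimes> \<one>\<^sub>-)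
      \<bullet> (\<one>\<^sub>+ \<otimes> Eta' \<otimes> \<one>\<^sub>-) \<bullet> Eta'"

definition cbub :: "int \<Rightarrow> tm" where
  "cbub k = (if k < 0 then Zro [] [] else bubble (nat k))"

text \<open>The two rotations of the cupcap by half a turn; they are identified below.\<close>

definition Emate_left :: tm where
  "Emate_left = (Eps \<otimes> \<one>\<^sub>- \<otimes> \<one>\<^sub>-) \<bullet> (\<one>\<^sub>- \<otimes> Eps \<otimes> \<one>\<^sub>+ \<otimes> \<one>\<^sub>- \<otimes> \<one>\<^sub>-)
     \<bullet> (\<one>\<^sub>- \<otimes> \<one>\<^sub>- \<otimes> Ecc \<otimes> \<one>\<^sub>- \<otimes> \<one>\<^sub>-)
     \<bullet> (\<one>\<^sub>- \<otimes> \<one>\<^sub>- \<otimes> \<one>\<^sub>+ \<otimes> Eta' \<otimes> \<one>\<^sub>-) \<bullet> (\<one>\<^sub>- \<otimes> \<one>\<^sub>- \<otimes> Eta')"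

definition Emate_right :: tm where
  "Emate_right = (\<one>\<^sub>- \<otimes> \<one>\<^sub>- \<otimes> Eps') \<bullet> (\<one>\<^sub>- \<otimes> \<one>\<^sub>- \<otimes> \<one>\<^sub>+ \<otimes> Eps' \<otimes> \<one>\<^sub>-)
     \<bullet> (\<one>\<^sub>- \<otimes> \<one>\<^sub>- \<otimes> Ecc \<otimes> \<one>\<^sub>- \<otimes> \<one>\<^sub>-)
     \<bullet> (\<one>\<^sub>- \<otimes> Eta \<otimes> \<one>\<^sub>+ \<otimes> \<one>\<^sub>- \<otimes> \<one>\<^sub>-) \<bullet> (Eta \<otimes> \<one>\<^sub>- \<otimes> \<one>\<^sub>-)"

abbreviation Estar :: tm where "Estar \<equiv> Emate_left"

text \<open>Ill-typed terms only ever get related to ill-typed terms, so on well-typed terms this is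
  the least congruence containing the axioms of a linear strict monoidal category and the
  defining relations.\<close>

inductive tm_eq :: "tm \<Rightarrow> tm \<Rightarrow> bool" (infix "\<approx>" 50) where
  refl: "f \<approx> f"
| sym: "f \<approx> g \<Longrightarrow> g \<approx> f"
| trans: "f \<approx> g \<Longrightarrow> g \<approx> h \<Longrightarrow> f \<approx> h"
| cong_comp: "f \<approx> f' \<Longrightarrow> g \<approx> g' \<Longrightarrow> g \<bullet> f \<approx> g' \<bullet> f'"
| cong_tens: "f \<approx> f' \<Longrightarrow> g \<approx> g' \<Longrightarrow> f \<otimes> g \<approx> f' \<otimes> g'"
| cong_plus: "f \<approx> f' \<Longrightarrow> g \<approx> g' \<Longrightarrow> f \<oplus> g \<approx> f' \<oplus> g'"
| cong_scal: "f \<approx> f' \<Longrightarrow> a \<odot> f \<approx> a \<odot> f'"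
| comp_id_right: "wt f \<Longrightarrow> f \<bullet> Idt (tdom f) \<approx> f"
| comp_id_left: "wt f \<Longrightarrow> Idt (tcod f) \<bullet> f \<approx> f"
| comp_assoc: "wt (h \<bullet> g \<bullet> f) \<Longrightarrow> (h \<bullet> g) \<bullet> f \<approx> h \<bullet> (g \<bullet> f)"
| plus_assoc: "wt (f \<oplus> g \<oplus> h) \<Longrightarrow> (f \<oplus> g) \<oplus> h \<approx> f \<oplus> (g \<oplus> h)"
| plus_comm: "wt (f \<oplus> g) \<Longrightarrow> f \<oplus> g \<approx> g \<oplus> f"
| plus_zero: "wt f \<Longrightarrow> f \<oplus> Zro (tdom f) (tcod f) \<approx> f"
| scal_zero: "wt f \<Longrightarrow> 0 \<odot> f \<approx> Zro (tdom f) (tcod f)"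
| scal_one: "wt f \<Longrightarrow> 1 \<odot> f \<approx> f"
| scal_mult: "wt f \<Longrightarrow> (a * b) \<odot> f \<approx> a \<odot> b \<odot> f"
| scal_add: "wt f \<Longrightarrow> (a + b) \<odot> f \<approx> (a \<odot> f) \<oplus> (b \<odot> f)"
| scal_plus: "wt (f \<oplus> g) \<Longrightarrow> a \<odot> (f \<oplus> g) \<approx> (a \<odot> f) \<oplus> (a \<odot> g)"
| comp_plus_left: "wt ((g \<oplus> g') \<bullet> f) \<Longrightarrow> (g \<oplus> g') \<bullet> f \<approx> g \<bullet> f \<oplus> g' \<bullet> f"
| comp_plus_right: "wt (g \<bullet> (f \<oplus> f')) \<Longrightarrow> g \<bullet> (f \<oplus> f') \<approx> g \<bullet> f \<oplus> g \<bullet> f'"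
| comp_scal_left: "wt (g \<bullet> f) \<Longrightarrow> (a \<odot> g) \<bullet> f \<approx> a \<odot> (g \<bullet> f)"
| comp_scal_right: "wt (g \<bullet> f) \<Longrightarrow> g \<bullet> (a \<odot> f) \<approx> a \<odot> (g \<bullet> f)"
| tens_plus_left: "wt ((f \<oplus> f') \<otimes> g) \<Longrightarrow> (f \<oplus> f') \<otimes> g \<approx> f \<otimes> g \<oplus> f' \<otimes> g"
| tens_plus_right: "wt (f \<otimes> (g \<oplus> g')) \<Longrightarrow> f \<otimes> (g \<oplus> g') \<approx> f \<otimes> g \<oplus> f \<otimes> g'"
| tens_scal_left: "wt (f \<otimes> g) \<Longrightarrow> (a \<odot> f) \<otimes> g \<approx> a \<odot> (f \<otimes> g)"
| tens_scal_right: "wt (f \<otimes> g) \<Longrightarrow> f \<otimes> (a \<odot> g) \<approx> a \<odot> (f \<otimes> g)"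
| tens_id: "Idt x \<otimes> Idt y \<approx> Idt (x @ y)"
| interchange: "wt (g \<bullet> f) \<Longrightarrow> wt (g' \<bullet> f') \<Longrightarrow>
    (g \<otimes> g') \<bullet> (f \<otimes> f') \<approx> (g \<bullet> f) \<otimes> (g' \<bullet> f')"
| tens_assoc: "wt (f \<otimes> g \<otimes> h) \<Longrightarrow> (f \<otimes> g) \<otimes> h \<approx> f \<otimes> (g \<otimes> h)"
| tens_unit_left: "wt f \<Longrightarrow> \<one> \<otimes> f \<approx> f"
| tens_unit_right: "wt f \<Longrightarrow> f \<otimes> \<one> \<approx> f"
| zigzag1: "(Eps' \<otimes> \<one>\<^sub>+) \<bullet> (\<one>\<^sub>+ \<otimes> Eta) \<approx> \<one>\<^sub>+"
| zigzag2: "(\<one>\<^sub>+ \<otimes> Eps) \<bullet> (Eta' \<otimes> \<one>\<^sub>+) \<approx> \<one>\<^sub>+"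
| zigzag3: "(\<one>\<^sub>- \<otimes> Eps') \<bullet> (Eta \<otimes> \<one>\<^sub>-) \<approx> \<one>\<^sub>-"
| zigzag4: "(Eps \<otimes> \<one>\<^sub>-) \<bullet> (\<one>\<^sub>- \<otimes> Eta') \<approx> \<one>\<^sub>-"
| mates: "Emate_left \<approx> Emate_right"
| rel1a: "(qint 2)^3 \<odot> (Ecc \<otimes> \<one>\<^sub>+) \<bullet> (\<one>\<^sub>+ \<otimes> Ecc) \<bullet> (Ecc \<otimes> \<one>\<^sub>+) \<approx> qint 2 \<odot> (Ecc \<otimes> \<one>\<^sub>+)"
| rel1b: "(qint 2)^3 \<odot> (\<one>\<^sub>+ \<otimes> Ecc) \<bullet> (Ecc \<otimes> \<one>\<^sub>+) \<bullet> (\<one>\<^sub>+ \<otimes> Ecc) \<approx> qint 2 \<odot> (\<one>\<^sub>+ \<otimes> Ecc)"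
| rel2a: "(qint 2)^2 \<odot> (Ecc \<otimes> \<one>\<^sub>-) \<bullet> (\<one>\<^sub>+ \<otimes> (Eta' \<bullet> Eps')) \<bullet> (Ecc \<otimes> \<one>\<^sub>-)
    \<approx> qint 2 \<odot> (Ecc \<otimes> \<one>\<^sub>-)"
| rel2b: "(qint 2)^2 \<odot> (\<one>\<^sub>- \<otimes> Ecc) \<bullet> ((Eta \<bullet> Eps) \<otimes> \<one>\<^sub>+) \<bullet> (\<one>\<^sub>- \<otimes> Ecc)
    \<approx> qint 2 \<odot> (\<one>\<^sub>- \<otimes> Ecc)"
| rel3a: "qint 2 \<odot> (Eps \<otimes> \<one>\<^sub>+) \<bullet> (\<one>\<^sub>- \<otimes> Ecc) \<bullet> (Eta \<otimes> \<one>\<^sub>+) \<approx> \<one>\<^sub>+"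
| rel3b: "qint 2 \<odot> (\<one>\<^sub>+ \<otimes> Eps') \<bullet> (Ecc \<otimes> \<one>\<^sub>-) \<bullet> (\<one>\<^sub>+ \<otimes> Eta') \<approx> (\<one> \<ominus> cbub 0) \<otimes> \<one>\<^sub>+"
| rel4a: "Eps \<bullet> Eta \<approx> qint 2 \<odot> \<one>"
| rel4b: "k \<ge> 0 \<Longrightarrow> Eps \<bullet> (\<one>\<^sub>- \<otimes> cbub k \<otimes> \<one>\<^sub>+) \<bullet> Eta
    \<approx> Box (- 2 * k + 1) \<bullet> cbub (k - 1) \<oplus> Bdag (- 2 * k) \<bullet> cbub k"
| rel5a: "Eps' \<bullet> Eta' \<approx> qint 2 \<odot> \<one> \<ominus> cbub 0 \<bullet> Bdag 0"
| rel5b: "k \<ge> 0 \<Longrightarrow> Eps' \<bullet> (\<one>\<^sub>+ \<otimes> cbub k \<otimes> \<one>\<^sub>-) \<bullet> Eta'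
    \<approx> Box (- 2 * k - 1) \<bullet> cbub k \<oplus> Bdag (- 2 * k - 2) \<bullet> cbub (k + 1)"
| rel6a: "k \<ge> 0 \<Longrightarrow> cbub k \<otimes> \<one>\<^sub>+ \<approx> cbub k \<otimes> \<one>\<^sub>+ \<otimes> (cbub k \<oplus> cbub (k - 1))"
| rel6b: "k \<ge> 0 \<Longrightarrow> \<one>\<^sub>+ \<otimes> cbub k \<approx> (cbub k \<oplus> cbub (k + 1)) \<otimes> \<one>\<^sub>+ \<otimes> cbub k"
| rel7a: "((\<one>\<^sub>- \<otimes> \<one>\<^sub>- \<otimes> Ecc) \<bullet> (\<one>\<^sub>- \<otimes> Eta \<otimes> \<one>\<^sub>+) \<bullet> Eta)
      \<bullet> (Eps \<bullet> (\<one>\<^sub>- \<otimes> Eps \<otimes> \<one>\<^sub>+) \<bullet> (\<one>\<^sub>- \<otimes> \<one>\<^sub>- \<otimes> Ecc))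
    \<approx> Estar \<otimes> Ecc"
| rel7b: "cbub 0 \<otimes> Ecc \<approx> Zro [Plus, Plus] [Plus, Plus]"
| rel8a: "k \<ge> 0 \<Longrightarrow> j \<ge> 0 \<Longrightarrow> cbub k \<bullet> cbub j \<approx> (if k = j then cbub k else Zro [] [])"
| rel8b: "Box k \<otimes> \<one>\<^sub>+ \<approx> \<one>\<^sub>+ \<otimes> Box (k + 1)"
| rel9: "k \<ge> 0 \<Longrightarrow> Bdag k \<bullet> Box k \<approx> \<one>"
| rel10a: "k \<ge> 0 \<Longrightarrow> cbub k \<otimes> \<one>\<^sub>- \<otimes> cbub k \<otimes> \<one>\<^sub>+ \<otimes> cbub k
    \<approx> (\<one>\<^sub>- \<otimes> cbub k \<otimes> \<one>\<^sub>+) \<bullet> Eta \<bullet> (cbub k \<bullet> Box (- 2 * k)) \<bullet> Eps \<bullet> (\<one>\<^sub>- \<otimes> cbub k \<otimes> \<one>\<^sub>+)"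
| rel10b: "k \<ge> 0 \<Longrightarrow> cbub (k - 1) \<otimes> \<one>\<^sub>- \<otimes> cbub k \<otimes> \<one>\<^sub>+ \<otimes> cbub (k - 1)
    \<approx> (\<one>\<^sub>- \<otimes> cbub k \<otimes> \<one>\<^sub>+) \<bullet> Eta \<bullet> (cbub (k - 1) \<bullet> Bdag (- 2 * k + 1)) \<bullet> Eps
        \<bullet> (\<one>\<^sub>- \<otimes> cbub k \<otimes> \<one>\<^sub>+)"
| rel11: "k \<ge> 0 \<Longrightarrow> qint 2 \<odot> Ecc \<bullet> (\<one>\<^sub>+ \<otimes> cbub k \<otimes> \<one>\<^sub>+)
    \<approx> qint 2 \<odot> (((\<one>\<^sub>+ \<otimes> cbub (k + 1) \<otimes> \<one>\<^sub>+) \<bullet> Ecc) \<otimes> cbub k)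
      \<oplus> qint 2 \<odot> (cbub k \<otimes> ((\<one>\<^sub>+ \<otimes> cbub (k - 1) \<otimes> \<one>\<^sub>+) \<bullet> Ecc))
      \<oplus> cbub (k + 1) \<otimes> \<one>\<^sub>+ \<otimes> cbub k \<otimes> \<one>\<^sub>+ \<otimes> cbub k \<otimes> Bdag (- 2 * k)
      \<oplus> cbub k \<otimes> \<one>\<^sub>+ \<otimes> cbub k \<otimes> \<one>\<^sub>+ \<otimes> cbub (k - 1) \<otimes> Box (- 2 * k + 1)
      \<ominus> cbub (k + 1) \<otimes> \<one>\<^sub>+ \<otimes> cbub (k + 1) \<otimes> \<one>\<^sub>+ \<otimes> cbub k \<otimes> Box (- 2 * k - 1)
      \<ominus> cbub k \<otimes> \<one>\<^sub>+ \<otimes> cbub (k - 1) \<otimes> \<one>\<^sub>+ \<otimes> cbub (k - 1) \<otimes> Bdag (- 2 * k + 2)"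

lemma Bdag_typed [simp]: "wt (Bdag k)" "tdom (Bdag k) = []" "tcod (Bdag k) = []"
  by (simp_all add: Bdag_def)

lemma bubble_typed: "wt (bubble k) \<and> tdom (bubble k) = [] \<and> tcod (bubble k) = []"
  by (induction k) (simp_all add: Pmor_def)

lemma cbub_typed [simp]: "wt (cbub k)" "tdom (cbub k) = []" "tcod (cbub k) = []"
  by (simp_all add: cbub_def bubble_typed)

lemma tm_eq_typed:
  assumes "f \<approx> g"
  shows "tdom f = tdom g \<and> tcod f = tcod g \<and> wt f = wt g"
  using assms
  by induction (auto simp: Emate_left_def Emate_right_def)

quotient_type arrow = tm / tm_eq
  by (rule equivpI) (auto simp: reflp_def symp_def transp_def intro: tm_eq.intros)

lift_definition adom :: "arrow \<Rightarrow> word" is tdom using tm_eq_typed by blast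
lift_definition acod :: "arrow \<Rightarrow> word" is tcod using tm_eq_typed by blast
lift_definition awt :: "arrow \<Rightarrow> bool" is wt using tm_eq_typed by blast
lift_definition aid :: "word \<Rightarrow> arrow" is Idt .
lift_definition azero :: "word \<Rightarrow> word \<Rightarrow> arrow" is Zro .
lift_definition acomp :: "arrow \<Rightarrow> arrow \<Rightarrow> arrow" is Comp by (rule cong_comp)
lift_definition atens :: "arrow \<Rightarrow> arrow \<Rightarrow> arrow" is Tens by (rule cong_tens)
lift_definition aplus :: "arrow \<Rightarrow> arrow \<Rightarrow> arrow" is Plus_tm by (rule cong_plus)
lift_definition ascal :: "scalar \<Rightarrow> arrow \<Rightarrow> arrow" is Scal by (rule cong_scal)
lift_definition ac :: "nat \<Rightarrow> arrow" is "\<lambda>k. cbub (int k)" .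

record ('k, 'o, 'm) lin_mon_cat =
  Ob :: "'o set"
  Hom :: "'o \<Rightarrow> 'o \<Rightarrow> 'm set"
  Ide :: "'o \<Rightarrow> 'm"
  Cmp :: "'m \<Rightarrow> 'm \<Rightarrow> 'm"
  Zer :: "'o \<Rightarrow> 'o \<Rightarrow> 'm"
  Pls :: "'m \<Rightarrow> 'm \<Rightarrow> 'm"
  Scl :: "'k \<Rightarrow> 'm \<Rightarrow> 'm"
  Unt :: "'o"
  TenO :: "'o \<Rightarrow> 'o \<Rightarrow> 'o"
  TenM :: "'m \<Rightarrow> 'm \<Rightarrow> 'm"

record ('k, 'o, 'm) additive_mon_cat = "('k, 'o, 'm) lin_mon_cat" +
  SumO :: "'o \<Rightarrow> 'o \<Rightarrow> 'o"
  SumM :: "'m \<Rightarrow> 'm \<Rightarrow> 'm"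

definition Wwords :: "(scalar, word, arrow) lin_mon_cat" where
  "Wwords = \<lparr> Ob = UNIV,
     Hom = (\<lambda>x y. {f. awt f \<and> adom f = x \<and> acod f = y}),
     Ide = aid, Cmp = acomp, Zer = azero, Pls = aplus, Scl = ascal,
     Unt = [], TenO = (@), TenM = atens \<rparr>"

text \<open>Objects are lists of objects, thought of as their direct sum. A morphism from \<open>X\<close> to \<open>Y\<close> is
  a matrix whose \<open>(i, j)\<close> entry is a morphism from \<open>X ! j\<close> to \<open>Y ! i\<close>; entries out of range are
  normalised, so that equality of matrices is equality of the entries in range.\<close>

datatype ('o, 'm) mtx = Mtx (src: "'o list") (tgt: "'o list") (ent: "nat \<Rightarrow> nat \<Rightarrow> 'm")

definition mk_mtx :: "'o list \<Rightarrow> 'o list \<Rightarrow> (nat \<Rightarrow> nat \<Rightarrow> 'm) \<Rightarrow> ('o, 'm) mtx" where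
  "mk_mtx X Y F =
     Mtx X Y (\<lambda>i j. if i < length Y \<and> j < length X then F i j else undefined)"

definition mtx_comp ::
    "('k, 'o, 'm) lin_mon_cat \<Rightarrow> ('o, 'm) mtx \<Rightarrow> ('o, 'm) mtx \<Rightarrow> ('o, 'm) mtx" where
  "mtx_comp C G F = mk_mtx (src F) (tgt G) (\<lambda>i j.
     foldr (\<lambda>k s. Pls C (Cmp C (ent G i k) (ent F k j)) s) [0..<length (tgt F)]
       (Zer C (src F ! j) (tgt G ! i)))"

definition sum_list_tens :: "('k, 'o, 'm) lin_mon_cat \<Rightarrow> 'o list \<Rightarrow> 'o list \<Rightarrow> 'o list" where
  "sum_list_tens C X Y = concat (map (\<lambda>x. map (\<lambda>y. TenO C x y) Y) X)"

text \<open>Kronecker product, with index pairs ordered as in \<^const>\<open>sum_list_tens\<close>.\<close>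
definition mtx_tens ::
    "('k, 'o, 'm) lin_mon_cat \<Rightarrow> ('o, 'm) mtx \<Rightarrow> ('o, 'm) mtx \<Rightarrow> ('o, 'm) mtx" where
  "mtx_tens C F G = mk_mtx (sum_list_tens C (src F) (src G)) (sum_list_tens C (tgt F) (tgt G))
     (\<lambda>i j. TenM C (ent F (i div length (tgt G)) (j div length (src G)))
                   (ent G (i mod length (tgt G)) (j mod length (src G))))"

definition mtx_dsum ::
    "('k, 'o, 'm) lin_mon_cat \<Rightarrow> ('o, 'm) mtx \<Rightarrow> ('o, 'm) mtx \<Rightarrow> ('o, 'm) mtx" where
  "mtx_dsum C F G = mk_mtx (src F @ src G) (tgt F @ tgt G) (\<lambda>i j.
     if i < length (tgt F) \<and> j < length (src F) then ent F i j
     else if i \<ge> length (tgt F) \<and> j \<ge> length (src F)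
       then ent G (i - length (tgt F)) (j - length (src F))
     else Zer C ((src F @ src G) ! j) ((tgt F @ tgt G) ! i))"

definition additive_closure ::
    "('k, 'o, 'm) lin_mon_cat \<Rightarrow> ('k, 'o list, ('o, 'm) mtx) additive_mon_cat" where
  "additive_closure C = \<lparr>
     Ob = lists (Ob C),
     Hom = (\<lambda>X Y. {mk_mtx X Y F | F.
              \<forall>i < length Y. \<forall>j < length X. F i j \<in> Hom C (X ! j) (Y ! i)}),
     Ide = (\<lambda>X. mk_mtx X X (\<lambda>i j. if i = j then Ide C (X ! i) else Zer C (X ! j) (X ! i))),
     Cmp = mtx_comp C,
     Zer = (\<lambda>X Y. mk_mtx X Y (\<lambda>i j. Zer C (X ! j) (Y ! i))),
     Pls = (\<lambda>F G. mk_mtx (src F) (tgt F) (\<lambda>i j. Pls C (ent F i j) (ent G i j))),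
     Scl = (\<lambda>a F. mk_mtx (src F) (tgt F) (\<lambda>i j. Scl C a (ent F i j))),
     Unt = [Unt C],
     TenO = sum_list_tens C,
     TenM = mtx_tens C,
     SumO = (@),
     SumM = mtx_dsum C \<rparr>"

text \<open>The object \<open>(X, e)\<close> is the image of the idempotent \<open>e\<close>; its identity morphism is \<open>e\<close>.\<close>

definition karoubi ::
    "('k, 'o, 'm) additive_mon_cat \<Rightarrow> ('k, 'o \<times> 'm, 'm) additive_mon_cat" where
  "karoubi C = \<lparr>
     Ob = {(X, e). X \<in> Ob C \<and> e \<in> Hom C X X \<and> Cmp C e e = e},
     Hom = (\<lambda>(X, e) (Y, f). {m \<in> Hom C X Y. Cmp C f (Cmp C m e) = m}),
     Ide = snd,
     Cmp = Cmp C,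
     Zer = (\<lambda>(X, e) (Y, f). Zer C X Y),
     Pls = Pls C,
     Scl = Scl C,
     Unt = (Unt C, Ide C (Unt C)),
     TenO = (\<lambda>(X, e) (Y, f). (TenO C X Y, TenM C e f)),
     TenM = TenM C,
     SumO = (\<lambda>(X, e) (Y, f). (SumO C X Y, SumM C e f)),
     SumM = SumM C \<rparr>"

definition isomorphic :: "('k, 'o, 'm, 'z) lin_mon_cat_scheme \<Rightarrow> 'o \<Rightarrow> 'o \<Rightarrow> bool" where
  "isomorphic C X Y \<longleftrightarrow> X \<in> Ob C \<and> Y \<in> Ob C \<and>
     (\<exists>f \<in> Hom C X Y. \<exists>g \<in> Hom C Y X. Cmp C g f = Ide C X \<and> Cmp C f g = Ide C Y)"

definition W' :: "(scalar, word list, (word, arrow) mtx) additive_mon_cat" where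
  "W' = additive_closure Wwords"

definition W :: "(scalar, word list \<times> (word, arrow) mtx, (word, arrow) mtx) additive_mon_cat" where
  "W = karoubi W'"

definition Qplus :: "word list \<times> (word, arrow) mtx" where
  "Qplus = ([[Plus]], Ide W' [[Plus]])"

definition Qminus :: "word list \<times> (word, arrow) mtx" where
  "Qminus = ([[Minus]], Ide W' [[Minus]])"

definition Cobj :: "nat \<Rightarrow> word list \<times> (word, arrow) mtx" where
  "Cobj k = (Unt W', mk_mtx (Unt W') (Unt W') (\<lambda>_ _. ac k))"

end

theory Submission
  imports Defs
begin

text \<open>
  Rotating \<open>[2] E\<close> by a quarter turn either way gives maps \<open>\<alpha>: Q\<^sub>- Q\<^sub>+ \<rightarrow> Q\<^sub>+ Q\<^sub>-\<close> and
  \<open>\<alpha>': Q\<^sub>+ Q\<^sub>- \<rightarrow> Q\<^sub>- Q\<^sub>+\<close>. Relations 2 and 3 give \<open>\<alpha> \<alpha>' = 1\<close> and \<open>\<alpha>' \<alpha> = 1 - p\<close>, where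
  \<open>p = 1\<^sub>- \<otimes> c\<^sub>0 \<otimes> 1\<^sub>+\<close>. By relation 6 and its rotation, \<open>p = c\<^sub>0 \<otimes> 1\<^sub>- \<otimes> c\<^sub>0 \<otimes> 1\<^sub>+ \<otimes> c\<^sub>0\<close>, so
  relation 10 factors \<open>p\<close> as \<open>u v\<close> with \<open>u = p \<eta> c\<^sub>0\<close> and \<open>v = c\<^sub>0 b\<^sub>0 \<epsilon> p\<close>. Relations 4 and 9,
  together with commutativity of \<open>End(\<one>)\<close>, give \<open>v u = c\<^sub>0\<close>: the idempotent \<open>p\<close> splits through
  \<open>C\<^sub>0\<close>.
\<close>

section \<open>Arrows between tensor words\<close>

notation acomp (infixr "\<cdot>" 70)
notation atens (infixr "\<star>" 75)
notation aplus (infixl "\<boxplus>" 65)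
notation ascal (infixr "*\<^sub>a" 68)

abbreviation typed :: "arrow \<Rightarrow> word \<Rightarrow> word \<Rightarrow> bool" where
  "typed f x y \<equiv> awt f \<and> adom f = x \<and> acod f = y"

lift_definition aeta :: arrow is Eta .
lift_definition aeps :: arrow is Eps .
lift_definition aeta' :: arrow is Eta' .
lift_definition aeps' :: arrow is Eps' .
lift_definition aE :: arrow is Ecc .
lift_definition abox :: "int \<Rightarrow> arrow" is Box .
lift_definition abdag :: "int \<Rightarrow> arrow" is Bdag .

text \<open>As simp rules these discharge the typing premises that the laws below inherit from
  terms.\<close>

lemma typing [simp]:
  "awt (aid x)" "adom (aid x) = x" "acod (aid x) = x"
  "awt (azero x y)" "adom (azero x y) = x" "acod (azero x y) = y"
  "awt aeta" "adom aeta = []" "acod aeta = [Minus, Plus]"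
  "awt aeps" "adom aeps = [Minus, Plus]" "acod aeps = []"
  "awt aeta'" "adom aeta' = []" "acod aeta' = [Plus, Minus]"
  "awt aeps'" "adom aeps' = [Plus, Minus]" "acod aeps' = []"
  "awt aE" "adom aE = [Plus, Plus]" "acod aE = [Plus, Plus]"
  "awt (abox k)" "adom (abox k) = []" "acod (abox k) = []"
  "awt (abdag k)" "adom (abdag k) = []" "acod (abdag k) = []"
  "awt (ac n)" "adom (ac n) = []" "acod (ac n) = []"
  "adom (g \<cdot> f) = adom f" "acod (g \<cdot> f) = acod g"
  "awt (g \<cdot> f) \<longleftrightarrow> awt g \<and> awt f \<and> acod f = adom g"
  "adom (f \<star> g) = adom f @ adom g" "acod (f \<star> g) = acod f @ acod g"
  "awt (f \<star> g) \<longleftrightarrow> awt f \<and> awt g"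
  "adom (f \<boxplus> g) = adom f" "acod (f \<boxplus> g) = acod f"
  "awt (f \<boxplus> g) \<longleftrightarrow> awt f \<and> awt g \<and> adom f = adom g \<and> acod f = acod g"
  "adom (a *\<^sub>a f) = adom f" "acod (a *\<^sub>a f) = acod f" "awt (a *\<^sub>a f) \<longleftrightarrow> awt f"
  by (transfer; simp)+

lemma acomp_id_right [simp]: "awt f \<Longrightarrow> adom f = x \<Longrightarrow> f \<cdot> aid x = f"
  by transfer (auto intro: comp_id_right)

lemma acomp_id_left [simp]: "awt f \<Longrightarrow> acod f = x \<Longrightarrow> aid x \<cdot> f = f"
  by transfer (auto intro: comp_id_left)

lemma acomp_assoc:
  "awt (h \<cdot> g \<cdot> f) \<Longrightarrow> (h \<cdot> g) \<cdot> f = h \<cdot> g \<cdot> f"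
  by transfer (rule comp_assoc)

lemma aplus_assoc: "awt (f \<boxplus> g \<boxplus> h) \<Longrightarrow> (f \<boxplus> g) \<boxplus> h = f \<boxplus> (g \<boxplus> h)"
  by transfer (rule plus_assoc)

lemma aplus_comm: "awt (f \<boxplus> g) \<Longrightarrow> f \<boxplus> g = g \<boxplus> f"
  by transfer (rule plus_comm)

lemma aplus_zero_right [simp]: "typed f x y \<Longrightarrow> f \<boxplus> azero x y = f"
  by transfer (auto intro: plus_zero)

lemma aplus_zero_left [simp]: "typed f x y \<Longrightarrow> azero x y \<boxplus> f = f"
  by (simp add: aplus_comm)

lemma ascal_zero [simp]: "awt f \<Longrightarrow> 0 *\<^sub>a f = azero (adom f) (acod f)"
  by transfer (rule scal_zero)

lemma ascal_one [simp]: "awt f \<Longrightarrow> 1 *\<^sub>a f = f"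
  by transfer (rule scal_one)

lemma ascal_mult: "awt f \<Longrightarrow> a *\<^sub>a b *\<^sub>a f = (a * b) *\<^sub>a f"
  by transfer (rule tm_eq.sym[OF scal_mult])

lemma ascal_add: "awt f \<Longrightarrow> (a + b) *\<^sub>a f = a *\<^sub>a f \<boxplus> b *\<^sub>a f"
  by transfer (rule scal_add)

lemma acomp_plus_left: "awt ((g \<boxplus> g') \<cdot> f) \<Longrightarrow> (g \<boxplus> g') \<cdot> f = g \<cdot> f \<boxplus> g' \<cdot> f"
  by transfer (rule comp_plus_left)

lemma acomp_plus_right: "awt (g \<cdot> (f \<boxplus> f')) \<Longrightarrow> g \<cdot> (f \<boxplus> f') = g \<cdot> f \<boxplus> g \<cdot> f'"
  by transfer (rule comp_plus_right)

lemma acomp_scal_left: "awt (g \<cdot> f) \<Longrightarrow> (a *\<^sub>a g) \<cdot> f = a *\<^sub>a (g \<cdot> f)"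
  by transfer (rule comp_scal_left)

lemma acomp_scal_right: "awt (g \<cdot> f) \<Longrightarrow> g \<cdot> (a *\<^sub>a f) = a *\<^sub>a (g \<cdot> f)"
  by transfer (rule comp_scal_right)

lemma atens_plus_left: "awt ((f \<boxplus> f') \<star> g) \<Longrightarrow> (f \<boxplus> f') \<star> g = f \<star> g \<boxplus> f' \<star> g"
  by transfer (rule tens_plus_left)

lemma atens_plus_right: "awt (f \<star> (g \<boxplus> g')) \<Longrightarrow> f \<star> (g \<boxplus> g') = f \<star> g \<boxplus> f \<star> g'"
  by transfer (rule tens_plus_right)

lemma atens_scal_left: "awt (f \<star> g) \<Longrightarrow> (a *\<^sub>a f) \<star> g = a *\<^sub>a (f \<star> g)"
  by transfer (rule tens_scal_left)

lemma atens_scal_right: "awt (f \<star> g) \<Longrightarrow> f \<star> (a *\<^sub>a g) = a *\<^sub>a (f \<star> g)"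
  by transfer (rule tens_scal_right)

lemma atens_id: "aid x \<star> aid y = aid (x @ y)"
  by transfer (rule tens_id)

lemma interchange:
  "awt (g \<cdot> f) \<Longrightarrow> awt (g' \<cdot> f') \<Longrightarrow> (g \<star> g') \<cdot> (f \<star> f') = (g \<cdot> f) \<star> (g' \<cdot> f')"
  by transfer (rule tm_eq.interchange)

lemma atens_assoc: "awt (f \<star> g \<star> h) \<Longrightarrow> (f \<star> g) \<star> h = f \<star> g \<star> h"
  by transfer (rule tens_assoc)

lemma atens_unit_left [simp]: "awt f \<Longrightarrow> aid [] \<star> f = f"
  by transfer (rule tens_unit_left)

lemma atens_unit_right [simp]: "awt f \<Longrightarrow> f \<star> aid [] = f"
  by transfer (rule tens_unit_right)

text \<open>A zero arrow is \<open>0\<close> times itself, and linearity of composition moves that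
  scalar outside the composite.\<close>

lemma acomp_zero_right [simp]:
  assumes "awt g" "adom g = y"
  shows "g \<cdot> azero x y = azero x (acod g)"
proof -
  have "g \<cdot> (0 *\<^sub>a azero x y) = 0 *\<^sub>a (g \<cdot> azero x y)"
    using assms by (subst acomp_scal_right) auto
  then show ?thesis using assms by simp
qed

lemma acomp_zero_left [simp]:
  assumes "awt f" "acod f = y"
  shows "azero y z \<cdot> f = azero (adom f) z"
proof -
  have "(0 *\<^sub>a azero y z) \<cdot> f = 0 *\<^sub>a (azero y z \<cdot> f)"
    using assms by (subst acomp_scal_left) auto
  then show ?thesis using assms by simp
qed

lemma aplus_neg:
  assumes "awt f"
  shows "f \<boxplus> (- 1) *\<^sub>a f = azero (adom f) (acod f)"
  using ascal_add[OF assms, of 1 "- 1"] assms by simp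

lemma atens_id_assoc: "awt f \<Longrightarrow> aid x \<star> aid y \<star> f = aid (x @ y) \<star> f"
  by (subst atens_id[symmetric], subst atens_assoc) auto

lemma whisker_left: "awt (g \<cdot> f) \<Longrightarrow> aid x \<star> (g \<cdot> f) = (aid x \<star> g) \<cdot> (aid x \<star> f)"
  by (subst interchange) auto

lemma whisker_right: "awt (g \<cdot> f) \<Longrightarrow> (g \<cdot> f) \<star> aid x = (g \<star> aid x) \<cdot> (f \<star> aid x)"
  by (subst interchange) auto

text \<open>Together with its mirror image below, this exchanges the heights of two diagrams
  standing side by side; bubbles are slid past cups and caps this way.\<close>

lemma atens_eq_left_right:
  "awt f \<Longrightarrow> awt g \<Longrightarrow> f \<star> g = (f \<star> aid (acod g)) \<cdot> (aid (adom f) \<star> g)"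
  by (subst interchange) auto

lemma atens_eq_right_left:
  "awt f \<Longrightarrow> awt g \<Longrightarrow> f \<star> g = (aid (acod f) \<star> g) \<cdot> (f \<star> aid (adom g))"
  by (subst interchange) auto

text \<open>Eckmann-Hilton: both composites equal the tensor product of \<open>z\<close> and
  \<open>w\<close>.\<close>

lemma unit_endomorphisms_commute: "typed z [] [] \<Longrightarrow> typed w [] [] \<Longrightarrow> z \<cdot> w = w \<cdot> z"
  using atens_eq_left_right[of z w] atens_eq_right_left[of z w] by simp

section \<open>The defining relations\<close>

lemma cbub_minus_1: "cbub (- 1) = Zro [] []"
  by (simp add: cbub_def)

text \<open>The relations are moved to arrows by rewriting rather than by \<open>transfer\<close>, which would also
  unfold the scalars, themselves elements of a quotient type.\<close>

lemma arrow_eqI: "f \<approx> g \<Longrightarrow> abs_arrow f = abs_arrow g"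
  by (simp add: arrow.abs_eq_iff)

lemmas arrow_abs = aeta.abs_eq aeps.abs_eq aeta'.abs_eq aeps'.abs_eq aE.abs_eq abox.abs_eq
  abdag.abs_eq ac.abs_eq aid.abs_eq azero.abs_eq acomp.abs_eq atens.abs_eq aplus.abs_eq
  ascal.abs_eq

text \<open>Evaluates the indices in the relations at k = 0, where the bubble of index -1 becomes
  zero and its summand drops out.\<close>

lemmas index_simps = of_nat_0 mult_zero_right add_0 diff_0 cbub_minus_1

lemma zigzag_minus: "(aid [Minus] \<star> aeps') \<cdot> (aeta \<star> aid [Minus]) = aid [Minus]"
  unfolding arrow_abs by (rule arrow_eqI, rule zigzag3)

lemma sideways_E_plus:
  "(qint 2)^2 *\<^sub>a ((aE \<star> aid [Minus]) \<cdot> (aid [Plus] \<star> (aeta' \<cdot> aeps')) \<cdot> (aE \<star> aid [Minus]))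
    = qint 2 *\<^sub>a (aE \<star> aid [Minus])"
  unfolding arrow_abs by (rule arrow_eqI, rule rel2a)

lemma sideways_E_minus:
  "(qint 2)^2 *\<^sub>a ((aid [Minus] \<star> aE) \<cdot> ((aeta \<cdot> aeps) \<star> aid [Plus]) \<cdot> (aid [Minus] \<star> aE))
    = qint 2 *\<^sub>a (aid [Minus] \<star> aE)"
  unfolding arrow_abs by (rule arrow_eqI, rule rel2b)

lemma left_trace_E:
  "qint 2 *\<^sub>a ((aeps \<star> aid [Plus]) \<cdot> (aid [Minus] \<star> aE) \<cdot> (aeta \<star> aid [Plus])) = aid [Plus]"
  unfolding arrow_abs by (rule arrow_eqI, rule rel3a)

lemma right_trace_E:
  "qint 2 *\<^sub>a ((aid [Plus] \<star> aeps') \<cdot> (aE \<star> aid [Minus]) \<cdot> (aid [Plus] \<star> aeta'))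
    = (aid [] \<boxplus> (- 1) *\<^sub>a ac 0) \<star> aid [Plus]"
  unfolding arrow_abs of_nat_0 by (rule arrow_eqI, rule rel3b)

lemma bubble0_in_loop:
  "aeps \<cdot> (aid [Minus] \<star> ac 0 \<star> aid [Plus]) \<cdot> aeta = abdag 0 \<cdot> ac 0"
proof -
  have "aeps \<cdot> (aid [Minus] \<star> ac 0 \<star> aid [Plus]) \<cdot> aeta
      = abox 1 \<cdot> azero [] [] \<boxplus> abdag 0 \<cdot> ac 0"
    unfolding arrow_abs
    by (rule arrow_eqI, use rel4b[OF order_refl] in \<open>simp only: index_simps\<close>)
  then show ?thesis by simp
qed

lemma bubble0_past_plus: "ac 0 \<star> aid [Plus] = ac 0 \<star> aid [Plus] \<star> ac 0"
proof -
  have "ac 0 \<star> aid [Plus] = ac 0 \<star> aid [Plus] \<star> (ac 0 \<boxplus> azero [] [])"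
    unfolding arrow_abs
    by (rule arrow_eqI, use rel6a[OF order_refl] in \<open>simp only: index_simps\<close>)
  then show ?thesis by simp
qed

lemma bubble0_idem: "ac 0 \<cdot> ac 0 = ac 0"
  unfolding arrow_abs
  by (rule arrow_eqI, use rel8a[OF order_refl order_refl] in \<open>simp only: simp_thms if_True index_simps\<close>)

lemma abdag0_abox0: "abdag 0 \<cdot> abox 0 = aid []"
  unfolding arrow_abs by (rule arrow_eqI, rule rel9, simp)

lemma bubble0_surgery:
  "ac 0 \<star> aid [Minus] \<star> ac 0 \<star> aid [Plus] \<star> ac 0
    = (aid [Minus] \<star> ac 0 \<star> aid [Plus]) \<cdot> aeta \<cdot> (ac 0 \<cdot> abox 0) \<cdot> aeps
        \<cdot> (aid [Minus] \<star> ac 0 \<star> aid [Plus])"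
  unfolding arrow_abs
  by (rule arrow_eqI, use rel10a[OF order_refl] in \<open>simp only: index_simps\<close>)

section \<open>The sideways cupcaps\<close>

definition p0 :: arrow where
  "p0 = aid [Minus] \<star> ac 0 \<star> aid [Plus]"

definition alpha :: arrow where
  "alpha = qint 2 *\<^sub>a ((aeps \<star> aid [Plus, Minus]) \<cdot> (aid [Minus] \<star> aE \<star> aid [Minus])
      \<cdot> (aid [Minus, Plus] \<star> aeta'))"

definition alpha' :: arrow where
  "alpha' = qint 2 *\<^sub>a ((aid [Minus, Plus] \<star> aeps') \<cdot> (aid [Minus] \<star> aE \<star> aid [Minus])
      \<cdot> (aeta \<star> aid [Plus, Minus]))"

text \<open>The box goes entirely into \<open>v0\<close>. The factor \<open>ac 0\<close> at the unit
  end of \<open>v0\<close> and \<open>u0\<close> makes them morphisms to and from the image of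
  \<open>ac 0\<close>.\<close>

definition v0 :: arrow where
  "v0 = (ac 0 \<cdot> abox 0) \<cdot> aeps \<cdot> p0"

definition u0 :: arrow where
  "u0 = p0 \<cdot> aeta \<cdot> ac 0"

lemma typed_splitting [simp]:
  "awt p0" "adom p0 = [Minus, Plus]" "acod p0 = [Minus, Plus]"
  "awt alpha" "adom alpha = [Minus, Plus]" "acod alpha = [Plus, Minus]"
  "awt alpha'" "adom alpha' = [Plus, Minus]" "acod alpha' = [Minus, Plus]"
  "awt v0" "adom v0 = [Minus, Plus]" "acod v0 = []"
  "awt u0" "adom u0 = []" "acod u0 = [Minus, Plus]"
  by (simp_all add: p0_def alpha_def alpha'_def v0_def u0_def)

text \<open>Normal form: scalars in front of a right-nested composite of whiskered generators, with
  adjacent identities merged.\<close>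

lemmas normalise = acomp_assoc atens_assoc atens_id atens_id_assoc whisker_left whisker_right
  acomp_scal_left acomp_scal_right atens_scal_left atens_scal_right ascal_mult

lemma alpha_alpha': "alpha \<cdot> alpha' = aid [Plus, Minus]"
proof -
  let ?l = "aeps \<star> aid [Plus, Minus]" and ?r = "aeta \<star> aid [Plus, Minus]"
  \<comment> \<open>The inner cup and cap meet as \<open>aeta'\<close> after \<open>aeps'\<close>
    between two cupcaps, which is the left side of relation 2.\<close>
  have "alpha \<cdot> alpha' = ?l \<cdot> (aid [Minus] \<star> ((qint 2)^2 *\<^sub>a
      ((aE \<star> aid [Minus]) \<cdot> (aid [Plus] \<star> (aeta' \<cdot> aeps')) \<cdot> (aE \<star> aid [Minus])))) \<cdot> ?r"
    by (simp add: alpha_def alpha'_def normalise power2_eq_square)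
  \<comment> \<open>One factor [2] survives and is used up by closing \<open>aE\<close> on the left;
    the last downward strand is only carried along.\<close>
  also have "\<dots> = (qint 2 *\<^sub>a ((aeps \<star> aid [Plus]) \<cdot> (aid [Minus] \<star> aE) \<cdot> (aeta \<star> aid [Plus])))
      \<star> aid [Minus]"
    unfolding sideways_E_plus by (simp add: normalise)
  also have "\<dots> = aid [Plus, Minus]"
    unfolding left_trace_E by (simp add: normalise)
  finally show ?thesis .
qed

text \<open>Mirror image of the previous computation. Now \<open>aE\<close> is closed on the right,
  which gives 1 - c_0 to the left of the upward strand, hence between the two strands.\<close>

lemma alpha'_alpha: "alpha' \<cdot> alpha = aid [Minus, Plus] \<boxplus> (- 1) *\<^sub>a p0"
proof -
  let ?l = "aid [Minus, Plus] \<star> aeps'" and ?r = "aid [Minus, Plus] \<star> aeta'"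
  have "alpha' \<cdot> alpha = ?l \<cdot> (((qint 2)^2 *\<^sub>a
      ((aid [Minus] \<star> aE) \<cdot> ((aeta \<cdot> aeps) \<star> aid [Plus]) \<cdot> (aid [Minus] \<star> aE))) \<star> aid [Minus])
      \<cdot> ?r"
    by (simp add: alpha_def alpha'_def normalise power2_eq_square)
  also have "\<dots> = aid [Minus] \<star>
      (qint 2 *\<^sub>a ((aid [Plus] \<star> aeps') \<cdot> (aE \<star> aid [Minus]) \<cdot> (aid [Plus] \<star> aeta')))"
    unfolding sideways_E_minus by (simp add: normalise)
  also have "\<dots> = aid [Minus, Plus] \<boxplus> (- 1) *\<^sub>a p0"
    unfolding right_trace_E p0_def
    by (simp add: normalise atens_plus_left atens_plus_right)
  finally show ?thesis .
qed

lemma alpha'_alpha_plus_p0: "alpha' \<cdot> alpha \<boxplus> p0 = aid [Minus, Plus]"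
proof -
  have "(- 1) *\<^sub>a p0 \<boxplus> p0 = azero [Minus, Plus] [Minus, Plus]"
    using aplus_neg[of p0] by (simp add: aplus_comm)
  then show ?thesis by (simp add: alpha'_alpha aplus_assoc)
qed

section \<open>Orthogonality of \<open>p0\<close> to the sideways cupcaps\<close>

lemma aplus_eq_self_imp_zero:
  assumes "awt (f \<boxplus> g)" "f \<boxplus> g = f"
  shows "g = azero (adom g) (acod g)"
proof -
  have "g = ((- 1) *\<^sub>a f \<boxplus> f) \<boxplus> g"
    using assms(1) aplus_neg[of f] by (simp add: aplus_comm)
  also have "\<dots> = (- 1) *\<^sub>a f \<boxplus> f"
    using assms(1) by (subst aplus_assoc) (simp, simp only: assms(2))
  also have "\<dots> = azero (adom g) (acod g)"
    using assms(1) aplus_neg[of f] by (simp add: aplus_comm)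
  finally show ?thesis .
qed

text \<open>Composing the decomposition of the identity with \<open>alpha\<close> gives
  \<open>alpha\<close> plus this product, because \<open>alpha'\<close> is a right inverse; cancel
  \<open>alpha\<close>. This supplies an off-diagonal zero of the final matrix product.\<close>

lemma alpha_p0: "alpha \<cdot> p0 = azero [Minus, Plus] [Plus, Minus]"
proof -
  have "alpha = alpha \<cdot> (alpha' \<cdot> alpha \<boxplus> p0)"
    by (simp add: alpha'_alpha_plus_p0)
  also have "\<dots> = (alpha \<cdot> alpha') \<cdot> alpha \<boxplus> alpha \<cdot> p0"
    by (simp add: acomp_plus_right acomp_assoc)
  finally have "alpha \<boxplus> alpha \<cdot> p0 = alpha"
    by (simp add: alpha_alpha')
  from aplus_eq_self_imp_zero[OF _ this] show ?thesis by simp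
qed

lemma p0_alpha': "p0 \<cdot> alpha' = azero [Plus, Minus] [Minus, Plus]"
proof -
  have "alpha' = (alpha' \<cdot> alpha \<boxplus> p0) \<cdot> alpha'"
    by (simp add: alpha'_alpha_plus_p0)
  also have "\<dots> = alpha' \<cdot> (alpha \<cdot> alpha') \<boxplus> p0 \<cdot> alpha'"
    by (simp add: acomp_plus_left acomp_assoc)
  finally have "alpha' \<boxplus> p0 \<cdot> alpha' = alpha'"
    by (simp add: alpha_alpha')
  from aplus_eq_self_imp_zero[OF _ this] show ?thesis by simp
qed

section \<open>Splitting off the bubble\<close>

text \<open>The rotation of \<open>bubble0_past_plus\<close> by half a turn.\<close>

lemma bubble0_past_minus: "aid [Minus] \<star> ac 0 = ac 0 \<star> aid [Minus] \<star> ac 0"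
proof -
  let ?l = "aid [Minus] \<star> aeps'" and ?r = "aeta \<star> aid [Minus]"
  have slide: "ac 0 \<cdot> aeps' = aeps' \<cdot> (ac 0 \<star> aid [Plus, Minus])"
    using atens_eq_left_right[of "ac 0" aeps'] atens_eq_right_left[of "ac 0" aeps'] by simp
  have l: "(aid [Minus] \<star> ac 0) \<cdot> ?l = ?l \<cdot> (aid [Minus] \<star> ac 0 \<star> aid [Plus, Minus])"
    using arg_cong[OF slide, of "\<lambda>f. aid [Minus] \<star> f"] by (simp add: normalise)
  have r: "(aid [Minus, Plus] \<star> ac 0 \<star> aid [Minus]) \<cdot> ?r = ?r \<cdot> (ac 0 \<star> aid [Minus])"
    using atens_eq_left_right[of aeta "ac 0 \<star> aid [Minus]"]
      atens_eq_right_left[of aeta "ac 0 \<star> aid [Minus]"] by simp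
  \<comment> \<open>Bending the downward strand into a zigzag creates an upward segment, to which
    relation 6 applies once the bubble has passed the cap.\<close>
  have "aid [Minus] \<star> ac 0 = (aid [Minus] \<star> ac 0) \<cdot> ?l \<cdot> ?r"
    by (simp add: zigzag_minus)
  also have "\<dots> = ((aid [Minus] \<star> ac 0) \<cdot> ?l) \<cdot> ?r"
    by (simp add: acomp_assoc)
  also have "\<dots> = ?l \<cdot> (aid [Minus] \<star> (ac 0 \<star> aid [Plus]) \<star> aid [Minus]) \<cdot> ?r"
    unfolding l by (simp add: normalise)
  also have "\<dots> = ?l \<cdot> (aid [Minus] \<star> (ac 0 \<star> aid [Plus] \<star> ac 0) \<star> aid [Minus]) \<cdot> ?r"
    by (simp only: bubble0_past_plus[symmetric])
  also have "ac 0 \<star> aid [Plus] \<star> ac 0 = (ac 0 \<star> aid [Plus]) \<cdot> (aid [Plus] \<star> ac 0)"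
    using atens_eq_left_right[of "ac 0" "aid [Plus] \<star> ac 0"] by simp
  also have "?l \<cdot> (aid [Minus] \<star> \<dots> \<star> aid [Minus]) \<cdot> ?r
      = (?l \<cdot> (aid [Minus] \<star> ac 0 \<star> aid [Plus, Minus]))
        \<cdot> ((aid [Minus, Plus] \<star> ac 0 \<star> aid [Minus]) \<cdot> ?r)"
    by (simp add: normalise)
  \<comment> \<open>The old bubble returns through the cap to the right of the strand, the new one
    leaves through the cup to its left, and the zigzag can be straightened.\<close>
  also have "\<dots> = (aid [Minus] \<star> ac 0) \<cdot> (?l \<cdot> ?r) \<cdot> (ac 0 \<star> aid [Minus])"
    unfolding l[symmetric] r by (simp add: acomp_assoc)
  also have "\<dots> = ac 0 \<star> aid [Minus] \<star> ac 0"
    using atens_eq_right_left[of "ac 0" "aid [Minus] \<star> ac 0"] by (simp add: zigzag_minus)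
  finally show ?thesis .
qed

lemma p0_idem: "p0 \<cdot> p0 = p0"
  by (simp add: p0_def interchange bubble0_idem)

lemma p0_split: "p0 = u0 \<cdot> v0"
proof -
  have "p0 = (aid [Minus] \<star> ac 0) \<star> aid [Plus]"
    by (simp add: p0_def atens_assoc)
  \<comment> \<open>The bubble between the strands forces one in each outer region, producing the
    shape required by relation 10.\<close>
  also have "\<dots> = ac 0 \<star> aid [Minus] \<star> (ac 0 \<star> aid [Plus])"
    by (subst bubble0_past_minus) (simp add: atens_assoc)
  also have "\<dots> = ac 0 \<star> aid [Minus] \<star> ac 0 \<star> aid [Plus] \<star> ac 0"
    by (simp only: bubble0_past_plus[symmetric])
  also have "\<dots> = p0 \<cdot> aeta \<cdot> (ac 0 \<cdot> abox 0) \<cdot> aeps \<cdot> p0"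
    unfolding bubble0_surgery p0_def ..
  \<comment> \<open>Doubling the bubble leaves one copy for each of \<open>u0\<close> and
    \<open>v0\<close>.\<close>
  also have "\<dots> = p0 \<cdot> aeta \<cdot> ((ac 0 \<cdot> ac 0) \<cdot> abox 0) \<cdot> aeps \<cdot> p0"
    by (simp only: bubble0_idem)
  also have "\<dots> = u0 \<cdot> v0"
    by (simp add: u0_def v0_def acomp_assoc)
  finally show ?thesis .
qed

lemma v0_u0: "v0 \<cdot> u0 = ac 0"
proof -
  have "v0 \<cdot> u0 = ac 0 \<cdot> abox 0 \<cdot> (aeps \<cdot> (p0 \<cdot> p0) \<cdot> aeta) \<cdot> ac 0"
    by (simp add: u0_def v0_def acomp_assoc)
  also have "aeps \<cdot> (p0 \<cdot> p0) \<cdot> aeta = abdag 0 \<cdot> ac 0"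
    unfolding p0_idem by (simp add: p0_def bubble0_in_loop)
  also have "ac 0 \<cdot> abox 0 \<cdot> (abdag 0 \<cdot> ac 0) \<cdot> ac 0
      = ac 0 \<cdot> (abox 0 \<cdot> abdag 0) \<cdot> (ac 0 \<cdot> ac 0)"
    by (simp add: acomp_assoc)
  \<comment> \<open>Relation 9 gives only the product in the other order; commutativity of the
    endomorphisms of the unit reverses it.\<close>
  also have "\<dots> = ac 0"
    by (simp add: unit_endomorphisms_commute[of "abox 0"] abdag0_abox0 bubble0_idem)
  finally show ?thesis .
qed

lemma alpha_u0: "alpha \<cdot> u0 = azero [] [Plus, Minus]"
proof -
  have "alpha \<cdot> u0 = (alpha \<cdot> p0) \<cdot> aeta \<cdot> ac 0"
    by (simp add: u0_def acomp_assoc)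
  then show ?thesis by (simp add: alpha_p0)
qed

lemma v0_alpha': "v0 \<cdot> alpha' = azero [Plus, Minus] []"
proof -
  have "v0 \<cdot> alpha' = (ac 0 \<cdot> abox 0) \<cdot> aeps \<cdot> (p0 \<cdot> alpha')"
    by (simp add: v0_def acomp_assoc)
  then show ?thesis by (simp add: p0_alpha')
qed

text \<open>A morphism of the Karoubi envelope must absorb the idempotents at its ends; this and
  \<open>u0_bubble0\<close> are that condition at C_0.\<close>

lemma bubble0_v0: "ac 0 \<cdot> v0 = v0"
proof -
  have "ac 0 \<cdot> v0 = (ac 0 \<cdot> ac 0) \<cdot> abox 0 \<cdot> aeps \<cdot> p0"
    by (simp add: v0_def acomp_assoc)
  then show ?thesis by (simp add: bubble0_idem v0_def acomp_assoc)
qed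

lemma u0_bubble0: "u0 \<cdot> ac 0 = u0"
  by (simp add: u0_def acomp_assoc bubble0_idem)

section \<open>The isomorphism\<close>

lemma mk_mtx_eqI:
  "(\<And>i j. i < length Y \<Longrightarrow> j < length X \<Longrightarrow> F i j = G i j) \<Longrightarrow> mk_mtx X Y F = mk_mtx X Y G"
  by (auto simp: mk_mtx_def fun_eq_iff)

lemma mk_mtx_sel [simp]:
  "src (mk_mtx X Y F) = X" "tgt (mk_mtx X Y F) = Y"
  "i < length Y \<Longrightarrow> j < length X \<Longrightarrow> ent (mk_mtx X Y F) i j = F i j"
  by (simp_all add: mk_mtx_def)

lemma mtx_comp_mk_mtx:
  "mtx_comp C (mk_mtx Y Z G) (mk_mtx X Y F) = mk_mtx X Z (\<lambda>i j.
     foldr (\<lambda>k s. Pls C (Cmp C (G i k) (F k j)) s) [0..<length Y] (Zer C (X ! j) (Z ! i)))"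
  unfolding mtx_comp_def by (auto intro!: mk_mtx_eqI foldr_cong)

lemma Wwords_sel [simp]:
  "Ob Wwords = UNIV" "Hom Wwords x y = {f. typed f x y}" "Ide Wwords = aid"
  "Cmp Wwords = acomp" "Zer Wwords = azero" "Pls Wwords = aplus" "Scl Wwords = ascal"
  "Unt Wwords = []" "TenO Wwords = (@)" "TenM Wwords = atens"
  by (simp_all add: Wwords_def)

lemma mk_mtx_in_HomI:
  "(\<And>i j. i < length Y \<Longrightarrow> j < length X \<Longrightarrow> F i j \<in> Hom C (X ! j) (Y ! i)) \<Longrightarrow>
    mk_mtx X Y F \<in> Hom (additive_closure C) X Y"
  by (auto simp: additive_closure_def)

abbreviation column :: "arrow \<Rightarrow> arrow \<Rightarrow> nat \<Rightarrow> nat \<Rightarrow> arrow" where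
  "column f g \<equiv> \<lambda>i j. if i = 0 then f else g"

abbreviation row :: "arrow \<Rightarrow> arrow \<Rightarrow> nat \<Rightarrow> nat \<Rightarrow> arrow" where
  "row f g \<equiv> \<lambda>i j. if j = 0 then f else g"

text \<open>The identity of the right-hand object: C_0 lives on the empty word, and its identity is
  the idempotent \<open>ac 0\<close> itself.\<close>

abbreviation diag_id_c0 :: "nat \<Rightarrow> nat \<Rightarrow> arrow" where
  "diag_id_c0 \<equiv> \<lambda>i j. if i = 0 then if j = 0 then aid [Plus, Minus] else azero [] [Plus, Minus]
     else if j = 0 then azero [Plus, Minus] [] else ac 0"

lemma Qminus_Qplus:
  "TenO W Qminus Qplus
    = ([[Minus, Plus]], mk_mtx [[Minus, Plus]] [[Minus, Plus]] (\<lambda>i j. aid [Minus, Plus]))"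
  by (auto simp: W_def karoubi_def W'_def additive_closure_def Qminus_def Qplus_def
      sum_list_tens_def mtx_tens_def atens_id intro!: mk_mtx_eqI)

lemma Qplus_Qminus_plus_C0:
  "SumO W (TenO W Qplus Qminus) (Cobj 0)
    = ([[Plus, Minus], []], mk_mtx [[Plus, Minus], []] [[Plus, Minus], []] diag_id_c0)"
  by (auto simp: W_def karoubi_def W'_def additive_closure_def Qminus_def Qplus_def Cobj_def
      sum_list_tens_def mtx_tens_def mtx_dsum_def atens_id less_Suc_eq intro!: mk_mtx_eqI)

lemma isomorphic_karoubiI:
  assumes "X \<in> Ob C" "e \<in> Hom C X X" "Cmp C e e = e"
    and "Y \<in> Ob C" "d \<in> Hom C Y Y" "Cmp C d d = d"
    and "f \<in> Hom C X Y" "Cmp C d (Cmp C f e) = f"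
    and "g \<in> Hom C Y X" "Cmp C e (Cmp C g d) = g"
    and "Cmp C g f = e" "Cmp C f g = d"
  shows "isomorphic (karoubi C) (X, e) (Y, d)"
  using assms by (auto simp: isomorphic_def karoubi_def intro!: bexI[of _ f] bexI[of _ g])

theorem theorem1:
  shows "isomorphic W (TenO W Qminus Qplus) (SumO W (TenO W Qplus Qminus) (Cobj 0))"
proof -
  let ?X = "[[Minus, Plus]]" and ?Y = "[[Plus, Minus], []]"
  let ?e = "mk_mtx ?X ?X (\<lambda>i j. aid [Minus, Plus])" and ?d = "mk_mtx ?Y ?Y diag_id_c0"
  let ?f = "mk_mtx ?X ?Y (column alpha v0)" and ?g = "mk_mtx ?Y ?X (row alpha' u0)"
  have Cmp_W': "Cmp W' = mtx_comp Wwords" and Ob_W': "Ob W' = UNIV"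
    by (simp_all add: W'_def additive_closure_def lists_UNIV)
  have hom: "?e \<in> Hom W' ?X ?X" "?d \<in> Hom W' ?Y ?Y" "?f \<in> Hom W' ?X ?Y" "?g \<in> Hom W' ?Y ?X"
    unfolding W'_def by (auto intro!: mk_mtx_in_HomI simp: less_Suc_eq)
  \<comment> \<open>\<open>upt_rec\<close> expands the sum over the middle index into its one or two
    terms.\<close>
  note comp = Cmp_W' mtx_comp_mk_mtx upt_rec
  have idem: "Cmp W' ?e ?e = ?e" "Cmp W' ?d ?d = ?d"
    by (auto simp: comp less_Suc_eq bubble0_idem intro!: mk_mtx_eqI)
  have absorb: "Cmp W' ?d (Cmp W' ?f ?e) = ?f" "Cmp W' ?e (Cmp W' ?g ?d) = ?g"
    by (auto simp: comp less_Suc_eq bubble0_v0 u0_bubble0 intro!: mk_mtx_eqI)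
  \<comment> \<open>The first product has the single entry \<open>alpha'\<close>
    \<open>alpha\<close> + \<open>u0\<close> \<open>v0\<close>; the second is two by two, with the
    vanishing products \<open>alpha\<close> \<open>u0\<close> and \<open>v0\<close>
    \<open>alpha'\<close> off the diagonal.\<close>
  have inverse: "Cmp W' ?g ?f = ?e" "Cmp W' ?f ?g = ?d"
    by (auto simp: comp less_Suc_eq p0_split[symmetric] alpha'_alpha_plus_p0 alpha_alpha'
        alpha_u0 v0_alpha' v0_u0 intro!: mk_mtx_eqI)
  have "isomorphic W (?X, ?e) (?Y, ?d)"
    unfolding W_def
    by (rule isomorphic_karoubiI[where f = ?f and g = ?g])
      (simp_all add: hom idem absorb inverse Ob_W')
  then show ?thesis
    by (simp only: Qminus_Qplus Qplus_Qminus_plus_C0)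
qed

end
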